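(* Let $R$ be a Gorenstein local (or graded) ring with maximal ideal $\mathfrak m$, $2,3\notin\mathfrak m$, let $I\subset R$ be a perfect ideal of height $3$ and let $\mathbb{A}:0\to A_3\xrightarrow{a_3}A_2\xrightarrow{a_2}A_1\xrightarrow{a_1}R$ be the minimal free resolution of $R/I$, with bases $\{e_i\}_{i=1}^{r_1}$, $\{f_h\}_{h=1}^{r_2}$, $\{g_u\}_{u=1}^{r_3}$ of $A_1,A_2,A_3$ and dual bases $\{\epsilon_i\},\{\phi_h\},\{\gamma_u\}$. Let structure maps $e\cdot e'$, $e\cdot f$, $e\cdot e'\cdot e''$, $w^{(3)}_2$, $w^{(2)}_2$ on $\mathbb{A}$ be chosen as in the context. Then for any choice of indices: (1) If $X:\bigwedge^3A_1\otimes\bigwedge^2A_3^*\to A_2^*$ is a linear map with $a_3^*\big(X(e_i\wedge e_j\wedge e_k\otimes\gamma_s\wedge\gamma_t)\big)=\langle e_i\cdot e_j\cdot e_k,\gamma_s\rangle\gamma_t-\langle e_i\cdot e_j\cdot e_k,\gamma_t\rangle\gamma_s$, then $$X(e_i\wedge e_j\wedge e_k\otimes\gamma_s\wedge\gamma_t)\equiv\sum_{h=1}^{r_2}\langle w^{(2)}_2(e_i\wedge e_j\wedge e_k\otimes f_h),\gamma_s\wedge\gamma_t\rangle\,\phi_h\pmod{\ker(a_3^* )}.$$ (2) If $Y:\bigwedge^3A_1\otimes A_3^*\otimes A_2^*\to A_1^*$ is a linear map such that for all $h$ $$\langle f_h,a_2^*(Y(e_i\wedge e_j\wedge e_k\otimes\gamma_s\otimes\phi_l))\rangle=\langle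 e_i\cdot e_j\cdot e_k,\gamma_s\rangle\langle f_h,\phi_l\rangle-\langle w^{(2)}_2(e_i\wedge e_j\wedge e_k\otimes f_h),\gamma_s\wedge a_3^*(\phi_l)\rangle-\langle e_i\cdot e_j,\phi_l\rangle\langle e_k\cdot f_h,\gamma_s\rangle+\langle e_i\cdot e_k,\phi_l\rangle\langle e_j\cdot f_h,\gamma_s\rangle-\langle e_j\cdot e_k,\phi_l\rangle\langle e_i\cdot f_h,\gamma_s\rangle,$$ then $$Y(e_i\wedge e_j\wedge e_k\otimes\gamma_s\otimes\phi_l)\equiv\sum_{t=1}^{r_1}\langle w^{(3)}_2(e_i\wedge e_j\wedge e_k\wedge e_t),\phi_l\otimes\gamma_s\rangle\,\epsilon_t\pmod{\ker(a_2^* )}.$$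
   Context: $\langle\cdot,\cdot\rangle$ is evaluation of a free module against its dual; $\langle g\otimes f,\phi\otimes\gamma\rangle=\langle g,\gamma\rangle\langle f,\phi\rangle$ on $A_3\otimes A_2$, and $\langle g\wedge g',\gamma\wedge\gamma'\rangle=\langle g,\gamma\rangle\langle g',\gamma'\rangle-\langle g,\gamma'\rangle\langle g',\gamma\rangle$. Structure maps on $\mathbb{A}$, chosen successively as (possibly non-unique) $R$-linear lifts: - $w^{(3)}_1:\bigwedge^2A_1\to A_2$, written $e\cdot e'$, with $a_2(e\cdot e')=a_1(e)e'-a_1(e')e$. - $w^{(2)}_1:A_1\otimes A_2\to A_3$, written $e\cdot f$, with $a_3(e\cdot f)=a_1(e)f-e\cdot a_2(f)$. - $w^{(1)}_1:\bigwedge^3A_1\to A_3$, written $e\cdot e'\cdot e''$, with $a_3(e\cdot e'\cdot e'')=a_1(e)\,e'\cdot e''-a_1(e')\,e\cdot e''+a_1(e'')\,e\cdot e'$. - $w^{(3)}_2:\bigwedge^4A_1\to A_3\otimes A_2$: a lift, along $A_3\otimes A_2\to S_2A_2$, $g\otimes f\mapsto a_3(g)f$, of $e_i\wedge e_j\wedge e_k\wedge e_l\mapsto (e_i\cdot e_j)(e_k\cdot e_l)-(e_i\cdot e_k)(e_j\cdot e_l)+(e_i\cdot e_l)(e_j\cdot e_k)$. - $w^{(2)}_2:\bigwedge^3A_1\otimes A_2\to\bigwedge^2A_3$: the lift, along $\bigwedge^2A_3\to A_2\otimes A_3\,(\cong A_3\otimes A_2)$, $g\wedge g'\mapsto a_3(g)\otimes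 g'-a_3(g')\otimes g$, of $e_i\wedge e_j\wedge e_k\otimes f\mapsto e_i\cdot e_j\otimes e_k\cdot f-e_i\cdot e_k\otimes e_j\cdot f+e_j\cdot e_k\otimes e_i\cdot f+w^{(3)}_2(e_i\wedge e_j\wedge e_k\wedge a_2(f))-f\otimes e_i\cdot e_j\cdot e_k$. *)

theory Defs
  imports
    "HOL-Analysis.Finite_Cartesian_Product"
    "HOL-Algebra.Algebraic_Closure_Type"
    "HOL-Library.Extended_Nat"
begin

unbundle no fps_syntax
no_notation Polynomials.var (\<open>X\<index>\<close>)

section \<open>Homological notions for commutative rings\<close>

text \<open>
  Modules are the records of HOL-Algebra.  Resolutions quantify over modules, and these have to
  live in some type; we take the functions from the naturals to the ring elements.
  Over a Noetherian ring this universe loses nothing.  It contains copies of all ideals, so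
  injectivity tested inside it is injectivity (Baer).  It contains the free module over each of
  its members, so projectivity tested inside it is projectivity.  A finitely generated module has
  a resolution by finite free modules, whose syzygies again lie in the universe.  Finally the terms
  of the minimal injective resolution of the ring have cardinality at most that of
  the ring or countable, whichever is larger.
\<close>

definition mod_hom ::
    "('a, 'c) ring_scheme \<Rightarrow> ('a, 'm, 'd) module_scheme \<Rightarrow> ('a, 'n, 'e) module_scheme \<Rightarrow> ('m \<Rightarrow> 'n) set" where
  "mod_hom R M N = {h \<in> hom (add_monoid M) (add_monoid N).
     \<forall>r\<in>carrier R. \<forall>x\<in>carrier M. h (r \<odot>\<^bsub>M\<^esub> x) = r \<odot>\<^bsub>N\<^esub> h x}"

definition mod_ker :: "('a, 'm, 'd) module_scheme \<Rightarrow> ('a, 'n, 'e) module_scheme \<Rightarrow> ('m \<Rightarrow> 'n) \<Rightarrow> 'm set" where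
  "mod_ker M N h = {x \<in> carrier M. h x = \<zero>\<^bsub>N\<^esub>}"

definition regular_module :: "'a ring \<Rightarrow> ('a, 'a) module" where
  "regular_module R = \<lparr>carrier = carrier R, monoid.mult = monoid.mult R, one = one R,
     ring.zero = ring.zero R, add = add R, module.smult = monoid.mult R\<rparr>"

definition quotient_module :: "'a ring \<Rightarrow> 'a set \<Rightarrow> ('a, 'a set) module" where
  "quotient_module R I = \<lparr>carrier = carrier (R Quot I), monoid.mult = monoid.mult (R Quot I),
     one = one (R Quot I), ring.zero = ring.zero (R Quot I), add = add (R Quot I),
     module.smult = (\<lambda>r C. (I +>\<^bsub>R\<^esub> r) \<otimes>\<^bsub>R Quot I\<^esub> C)\<rparr>"

definition injective_module :: "'a ring \<Rightarrow> ('a, 'u) module \<Rightarrow> bool" where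
  "injective_module R E \<longleftrightarrow> Module.module R E \<and>
     (\<forall>(M :: ('a, 'u) module) (N :: ('a, 'u) module) i f.
        Module.module R M \<and> Module.module R N \<and>
        i \<in> mod_hom R M N \<and> inj_on i (carrier M) \<and> f \<in> mod_hom R M E \<longrightarrow>
        (\<exists>g\<in>mod_hom R N E. \<forall>x\<in>carrier M. g (i x) = f x))"

definition projective_module :: "'a ring \<Rightarrow> ('a, 'u) module \<Rightarrow> bool" where
  "projective_module R P \<longleftrightarrow> Module.module R P \<and>
     (\<forall>(M :: ('a, 'u) module) (N :: ('a, 'u) module) q f.
        Module.module R M \<and> Module.module R N \<and>
        q \<in> mod_hom R M N \<and> q ` carrier M = carrier N \<and> f \<in> mod_hom R P N \<longrightarrow>
        (\<exists>g\<in>mod_hom R P M. \<forall>x\<in>carrier P. q (g x) = f x))"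

text \<open>Exactness of \<open>0 \<rightarrow> M \<rightarrow> E\<^sub>0 \<rightarrow> E\<^sub>1 \<rightarrow> \<dots>\<close> with injective terms, and dually.\<close>

definition injective_resolution ::
    "'a ring \<Rightarrow> ('a, 'm) module \<Rightarrow> (nat \<Rightarrow> ('a, 'u) module) \<Rightarrow> (nat \<Rightarrow> 'u \<Rightarrow> 'u) \<Rightarrow> ('m \<Rightarrow> 'u) \<Rightarrow> bool" where
  "injective_resolution R M E d \<eta> \<longleftrightarrow>
     (\<forall>i. injective_module R (E i)) \<and>
     (\<forall>i. d i \<in> mod_hom R (E i) (E (Suc i))) \<and>
     \<eta> \<in> mod_hom R M (E 0) \<and> inj_on \<eta> (carrier M) \<and>
     \<eta> ` carrier M = mod_ker (E 0) (E 1) (d 0) \<and>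
     (\<forall>i. d i ` carrier (E i) = mod_ker (E (Suc i)) (E (Suc (Suc i))) (d (Suc i)))"

definition projective_resolution ::
    "'a ring \<Rightarrow> ('a, 'm) module \<Rightarrow> (nat \<Rightarrow> ('a, 'u) module) \<Rightarrow> (nat \<Rightarrow> 'u \<Rightarrow> 'u) \<Rightarrow> ('u \<Rightarrow> 'm) \<Rightarrow> bool" where
  "projective_resolution R M P d \<eta> \<longleftrightarrow>
     (\<forall>i. projective_module R (P i)) \<and>
     (\<forall>i. d i \<in> mod_hom R (P (Suc i)) (P i)) \<and>
     \<eta> \<in> mod_hom R (P 0) M \<and> \<eta> ` carrier (P 0) = carrier M \<and>
     d 0 ` carrier (P 1) = mod_ker (P 0) M \<eta> \<and>
     (\<forall>i. d (Suc i) ` carrier (P (Suc (Suc i))) = mod_ker (P (Suc i)) (P i) (d i))"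

definition injdim :: "'a ring \<Rightarrow> ('a, 'm) module \<Rightarrow> enat" where
  "injdim R M = Inf {enat n |n. \<exists>(E :: nat \<Rightarrow> ('a, nat \<Rightarrow> 'a) module) d \<eta>.
     injective_resolution R M E d \<eta> \<and> (\<forall>i>n. carrier (E i) = {\<zero>\<^bsub>E i\<^esub>})}"

definition projdim :: "'a ring \<Rightarrow> ('a, 'm) module \<Rightarrow> enat" where
  "projdim R M = Inf {enat n |n. \<exists>(P :: nat \<Rightarrow> ('a, nat \<Rightarrow> 'a) module) d \<eta>.
     projective_resolution R M P d \<eta> \<and> (\<forall>i>n. carrier (P i) = {\<zero>\<^bsub>P i\<^esub>})}"

definition regular_sequence :: "'a ring \<Rightarrow> 'a list \<Rightarrow> bool" where
  "regular_sequence R xs \<longleftrightarrow> set xs \<subseteq> carrier R \<and> genideal R (set xs) \<noteq> carrier R \<and>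
     (\<forall>i<length xs. \<forall>r\<in>carrier R.
        r \<otimes>\<^bsub>R\<^esub> xs ! i \<in> genideal R (set (take i xs)) \<longrightarrow> r \<in> genideal R (set (take i xs)))"

definition grade :: "'a ring \<Rightarrow> 'a set \<Rightarrow> enat" where
  "grade R I = Sup {enat (length xs) |xs. regular_sequence R xs \<and> set xs \<subseteq> I}"

definition perfect_ideal :: "'a ring \<Rightarrow> 'a set \<Rightarrow> bool" where
  "perfect_ideal R I \<longleftrightarrow> ideal I R \<and> I \<noteq> carrier R \<and> projdim R (quotient_module R I) = grade R I"

definition prime_height :: "'a ring \<Rightarrow> 'a set \<Rightarrow> enat" where
  "prime_height R Q = Sup {enat n |n. \<exists>C :: nat \<Rightarrow> 'a set.
     (\<forall>i\<le>n. primeideal (C i) R) \<and> (\<forall>i<n. C i \<subset> C (Suc i)) \<and> C n = Q}"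

definition ideal_height :: "'a ring \<Rightarrow> 'a set \<Rightarrow> enat" where
  "ideal_height R I = Inf {prime_height R Q |Q. primeideal Q R \<and> I \<subseteq> Q}"

definition local_ring :: "'a ring \<Rightarrow> 'a set \<Rightarrow> bool" where
  "local_ring R \<mm> \<longleftrightarrow> cring R \<and> noetherian_ring R \<and> maximalideal \<mm> R \<and>
     (\<forall>J. maximalideal J R \<longrightarrow> J = \<mm>)"

definition gorenstein_local :: "'a ring \<Rightarrow> 'a set \<Rightarrow> bool" where
  "gorenstein_local R \<mm> \<longleftrightarrow> local_ring R \<mm> \<and> injdim R (regular_module R) < \<infinity>"


section \<open>Graded rings\<close>

abbreviation ring_of :: "'a::comm_ring_1 ring" where
  "ring_of \<equiv> ring_of_type_algebra"

definition homogeneous_parts :: "(int \<Rightarrow> 'a::comm_ring_1 set) \<Rightarrow> 'a \<Rightarrow> (int \<Rightarrow> 'a) \<Rightarrow> bool" where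
  "homogeneous_parts G x c \<longleftrightarrow>
     (\<forall>n. c n \<in> G n) \<and> finite {n. c n \<noteq> 0} \<and> x = (\<Sum>n | c n \<noteq> 0. c n)"

text \<open>
  Gradings are by the naturals; the index runs over the integers, with zero components in negative
  degrees, so that degree differences can be used as indices.
\<close>

definition ring_grading :: "(int \<Rightarrow> 'a::comm_ring_1 set) \<Rightarrow> bool" where
  "ring_grading G \<longleftrightarrow>
     (\<forall>n. additive_subgroup (G n) ring_of) \<and> (\<forall>n<0. G n = {0}) \<and> 1 \<in> G 0 \<and>
     (\<forall>i j. \<forall>x\<in>G i. \<forall>y\<in>G j. x * y \<in> G (i + j)) \<and>
     (\<forall>x. \<exists>!c. homogeneous_parts G x c)"

definition homogeneous_ideal :: "(int \<Rightarrow> 'a::comm_ring_1 set) \<Rightarrow> 'a set \<Rightarrow> bool" where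
  "homogeneous_ideal G J \<longleftrightarrow> ideal J ring_of \<and>
     (\<forall>x\<in>J. \<forall>c. homogeneous_parts G x c \<longrightarrow> (\<forall>n. c n \<in> J))"

text \<open>
  A ring graded in this way with a unique homogeneous maximal ideal \<open>\<mm>\<close> has finite Krull dimension
  (the height of \<open>\<mm>\<close>), so finite self-injective dimension is equivalent to all localizations
  being Gorenstein.
\<close>

definition gorenstein_graded :: "(int \<Rightarrow> 'a::comm_ring_1 set) \<Rightarrow> 'a set \<Rightarrow> bool" where
  "gorenstein_graded G \<mm> \<longleftrightarrow> ring_grading G \<and> noetherian_ring (ring_of :: 'a ring) \<and>
     maximalideal \<mm> ring_of \<and> homogeneous_ideal G \<mm> \<and>
     (\<forall>J. maximalideal J ring_of \<and> homogeneous_ideal G J \<longrightarrow> J = \<mm>) \<and>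
     injdim ring_of (regular_module (ring_of :: 'a ring)) < \<infinity>"


section \<open>Free modules, their bases and duals\<close>

text \<open>
  The free module of rank \<open>r\<close> is \<open>'a ^ 'r\<close>; its bases are arbitrary families indexed by \<open>'r\<close>.
\<close>

lemma module_vec: "Modules.module ((*s) :: 'a::comm_ring_1 \<Rightarrow> 'a ^ 'n \<Rightarrow> 'a ^ 'n)"
  by unfold_locales (simp_all add: vec_eq_iff algebra_simps)

lemma module_self: "Modules.module ((*) :: 'a::comm_ring_1 \<Rightarrow> 'a \<Rightarrow> 'a)"
  by unfold_locales (simp_all add: algebra_simps)

abbreviation vec_linear :: "('a::comm_ring_1 ^ 'm \<Rightarrow> 'a ^ 'n) \<Rightarrow> bool" where
  "vec_linear \<equiv> Modules.module_hom (*s) (*s)"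

abbreviation functional :: "('a::comm_ring_1 ^ 'm \<Rightarrow> 'a) \<Rightarrow> bool" where
  "functional \<equiv> Modules.module_hom (*s) (*)"

definition is_basis :: "('n \<Rightarrow> 'a::comm_ring_1 ^ 'n) \<Rightarrow> bool" where
  "is_basis b \<longleftrightarrow> inj b \<and> \<not> Modules.module.dependent (*s) (range b) \<and>
     Modules.module.span (*s) (range b) = UNIV"

lemma functional_0: "functional (\<lambda>_ :: 'a::comm_ring_1 ^ 'n. 0)"
  by (intro module_hom.intro module_vec module_self module_hom_axioms.intro) simp_all

typedef (overloaded) ('a, 'n) dual = "{\<phi> :: 'a::comm_ring_1 ^ 'n::finite \<Rightarrow> 'a. functional \<phi>}"
  using functional_0 by blast

setup_lifting type_definition_dual

lift_definition eval :: "'a::comm_ring_1 ^ 'n::finite \<Rightarrow> ('a, 'n) dual \<Rightarrow> 'a" (\<open>\<langle>_, _\<rangle>\<close>)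
  is "\<lambda>x \<phi>. \<phi> x" .

lemma dual_eqI: "(\<And>x. \<langle>x, \<phi>\<rangle> = \<langle>x, \<psi>\<rangle>) \<Longrightarrow> \<phi> = \<psi>"
  by transfer (simp add: fun_eq_iff)

lemma functional_iff:
  "functional f \<longleftrightarrow> (\<forall>x y. f (x + y) = f x + f y) \<and> (\<forall>c x. f (c *s x) = c * f x)"
  by (auto simp: module_hom_def module_hom_axioms_def module_vec module_self)

lemma vec_linear_iff:
  "vec_linear f \<longleftrightarrow> (\<forall>x y. f (x + y) = f x + f y) \<and> (\<forall>c x. f (c *s x) = c *s f x)"
  by (auto simp: module_hom_def module_hom_axioms_def module_vec)

instantiation dual :: (comm_ring_1, finite) ab_group_add
begin

lift_definition zero_dual :: "('a, 'b) dual" is "\<lambda>_. 0"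
  by (rule functional_0)
lift_definition plus_dual :: "('a, 'b) dual \<Rightarrow> ('a, 'b) dual \<Rightarrow> ('a, 'b) dual" is "\<lambda>\<phi> \<psi> x. \<phi> x + \<psi> x"
  by (simp add: functional_iff algebra_simps)
lift_definition minus_dual :: "('a, 'b) dual \<Rightarrow> ('a, 'b) dual \<Rightarrow> ('a, 'b) dual" is "\<lambda>\<phi> \<psi> x. \<phi> x - \<psi> x"
  by (simp add: functional_iff algebra_simps)
lift_definition uminus_dual :: "('a, 'b) dual \<Rightarrow> ('a, 'b) dual" is "\<lambda>\<phi> x. - \<phi> x"
  by (simp add: functional_iff algebra_simps)

instance
  by standard (transfer; simp add: fun_eq_iff algebra_simps)+

end

lift_definition dual_scale :: "'a::comm_ring_1 \<Rightarrow> ('a, 'n::finite) dual \<Rightarrow> ('a, 'n) dual" (infixr \<open>*d\<close> 70)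
  is "\<lambda>c \<phi> x. c * \<phi> x"
  by (simp add: functional_iff algebra_simps)

lemma module_dual: "Modules.module ((*d) :: 'a::comm_ring_1 \<Rightarrow> ('a, 'n::finite) dual \<Rightarrow> ('a, 'n) dual)"
  by standard (transfer; simp add: fun_eq_iff algebra_simps)+

definition dual_map ::
    "('a::comm_ring_1 ^ 'm::finite \<Rightarrow> 'a ^ 'n::finite) \<Rightarrow> ('a, 'n) dual \<Rightarrow> ('a, 'm) dual" where
  "dual_map a \<phi> = Abs_dual (\<lambda>x. \<langle>a x, \<phi>\<rangle>)"

lemma eval_dual_map:
  assumes "vec_linear a"
  shows "\<langle>x, dual_map a \<phi>\<rangle> = \<langle>a x, \<phi>\<rangle>"
proof -
  have "functional (\<lambda>x. \<langle>a x, \<phi>\<rangle>)"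
    using assms unfolding functional_iff vec_linear_iff
    by (transfer fixing: a) (simp add: functional_iff)
  then show ?thesis
    unfolding dual_map_def by (simp add: eval.rep_eq Abs_dual_inverse)
qed

definition dual_bases ::
    "('n \<Rightarrow> 'a::comm_ring_1 ^ 'n) \<Rightarrow> ('n::finite \<Rightarrow> ('a, 'n) dual) \<Rightarrow> bool" where
  "dual_bases b \<beta> \<longleftrightarrow> is_basis b \<and> (\<forall>i j. \<langle>b i, \<beta> j\<rangle> = (if i = j then 1 else 0))"


section \<open>Minimal free resolutions of length three\<close>

definition free_resolution3 ::
    "'a::comm_ring_1 set \<Rightarrow> ('a ^ 'r1 \<Rightarrow> 'a) \<Rightarrow> ('a ^ 'r2 \<Rightarrow> 'a ^ 'r1) \<Rightarrow> ('a ^ 'r3 \<Rightarrow> 'a ^ 'r2) \<Rightarrow> bool" where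
  "free_resolution3 I a1 a2 a3 \<longleftrightarrow>
     functional a1 \<and> vec_linear a2 \<and> vec_linear a3 \<and>
     range a1 = I \<and> range a2 = {x. a1 x = 0} \<and> range a3 = {x. a2 x = 0} \<and> inj a3"

definition minimal_free_resolution3 ::
    "'a::comm_ring_1 set \<Rightarrow> 'a set \<Rightarrow>
     ('a ^ 'r1 \<Rightarrow> 'a) \<Rightarrow> ('a ^ 'r2 \<Rightarrow> 'a ^ 'r1) \<Rightarrow> ('a ^ 'r3 \<Rightarrow> 'a ^ 'r2) \<Rightarrow> bool" where
  "minimal_free_resolution3 \<mm> I a1 a2 a3 \<longleftrightarrow> free_resolution3 I a1 a2 a3 \<and>
     range a1 \<subseteq> \<mm> \<and>
     range a2 \<subseteq> Modules.module.span (*s) {c *s x |c x. c \<in> \<mm>} \<and>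
     range a3 \<subseteq> Modules.module.span (*s) {c *s x |c x. c \<in> \<mm>}"

text \<open>
  In the graded case the free modules have homogeneous bases \<open>b1\<close>, \<open>b2\<close>, \<open>b3\<close> of degrees \<open>d1\<close>,
  \<open>d2\<close>, \<open>d3\<close> for which the differentials preserve degrees.
\<close>

definition graded_minimal_free_resolution3 ::
    "(int \<Rightarrow> 'a::comm_ring_1 set) \<Rightarrow> 'a set \<Rightarrow> 'a set \<Rightarrow>
     ('a ^ 'r1 \<Rightarrow> 'a) \<Rightarrow> ('a ^ 'r2 \<Rightarrow> 'a ^ 'r1) \<Rightarrow> ('a ^ 'r3 \<Rightarrow> 'a ^ 'r2) \<Rightarrow> bool" where
  "graded_minimal_free_resolution3 G \<mm> I a1 a2 a3 \<longleftrightarrow> minimal_free_resolution3 \<mm> I a1 a2 a3 \<and>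
     (\<exists>b1 b2 b3 (d1 :: 'r1 \<Rightarrow> int) (d2 :: 'r2 \<Rightarrow> int) (d3 :: 'r3 \<Rightarrow> int).
        is_basis b1 \<and> is_basis b2 \<and> is_basis b3 \<and>
        (\<forall>i. a1 (b1 i) \<in> G (d1 i)) \<and>
        (\<forall>j. \<exists>c. (\<forall>i. c i \<in> G (d2 j - d1 i)) \<and> a2 (b2 j) = (\<Sum>i\<in>UNIV. c i *s b1 i)) \<and>
        (\<forall>j. \<exists>c. (\<forall>i. c i \<in> G (d3 j - d2 i)) \<and> a3 (b3 j) = (\<Sum>i\<in>UNIV. c i *s b2 i)))"


section \<open>Multilinear algebra\<close>

text \<open>
  A linear map out of an exterior power is given by the corresponding alternating multilinear
  map: an argument \<open>x\<^sub>1 \<and> \<dots> \<and> x\<^sub>k\<close> becomes the list \<open>[x\<^sub>1, \<dots>, x\<^sub>k]\<close>.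
\<close>

definition alternating ::
    "nat \<Rightarrow> ('a::comm_ring_1 \<Rightarrow> 'm::ab_group_add \<Rightarrow> 'm) \<Rightarrow> ('a \<Rightarrow> 'n::ab_group_add \<Rightarrow> 'n) \<Rightarrow> ('m list \<Rightarrow> 'n) \<Rightarrow> bool" where
  "alternating k s t w \<longleftrightarrow> (\<forall>xs. length xs = k \<longrightarrow>
     (\<forall>i<k. Modules.module_hom s t (\<lambda>x. w (xs[i := x]))) \<and> (\<not> distinct xs \<longrightarrow> w xs = 0))"

definition bilinear_map ::
    "('a::comm_ring_1 \<Rightarrow> 'm::ab_group_add \<Rightarrow> 'm) \<Rightarrow> ('a \<Rightarrow> 'n::ab_group_add \<Rightarrow> 'n) \<Rightarrow> ('a \<Rightarrow> 'p::ab_group_add \<Rightarrow> 'p) \<Rightarrow>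
     ('m \<Rightarrow> 'n \<Rightarrow> 'p) \<Rightarrow> bool" where
  "bilinear_map s t u w \<longleftrightarrow>
     (\<forall>y. Modules.module_hom s u (\<lambda>x. w x y)) \<and> (\<forall>x. Modules.module_hom t u (w x))"

text \<open>The tensor product of \<open>'a ^ 'm\<close> and \<open>'a ^ 'n\<close> is \<open>'a ^ ('m \<times> 'n)\<close>.\<close>

definition tensor :: "'a::comm_ring_1 ^ 'm::finite \<Rightarrow> 'a ^ 'n::finite \<Rightarrow> 'a ^ ('m \<times> 'n)" (infixl \<open>\<otimes>\<^sub>t\<close> 75) where
  "x \<otimes>\<^sub>t y = (\<chi> p. x $ fst p * y $ snd p)"

definition tensor_swap :: "'a::comm_ring_1 ^ ('m::finite \<times> 'n::finite) \<Rightarrow> 'a ^ ('n \<times> 'm)" where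
  "tensor_swap T = (\<chi> p. T $ (snd p, fst p))"

text \<open>The map \<open>a \<otimes> id\<close>.\<close>

definition tensor_map_left ::
    "('a::comm_ring_1 ^ 'm::finite \<Rightarrow> 'a ^ 'k::finite) \<Rightarrow> 'a ^ ('m \<times> 'n::finite) \<Rightarrow> 'a ^ ('k \<times> 'n)" where
  "tensor_map_left a T = (\<chi> p. a (\<chi> u. T $ (u, snd p)) $ fst p)"

text \<open>The pairing of a tensor with two functionals, extending \<open>(x \<otimes> y, \<gamma>, \<phi>) \<mapsto> \<langle>x, \<gamma>\<rangle>\<langle>y, \<phi>\<rangle>\<close>.\<close>

definition tensor_eval ::
    "'a::comm_ring_1 ^ ('m::finite \<times> 'n::finite) \<Rightarrow> ('a, 'm) dual \<Rightarrow> ('a, 'n) dual \<Rightarrow> 'a" where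
  "tensor_eval T \<gamma> \<phi> = \<langle>\<chi> u. \<langle>\<chi> h. T $ (u, h), \<phi>\<rangle>, \<gamma>\<rangle>"

lemma eval_scale: "\<langle>c *s x, \<phi>\<rangle> = c * \<langle>x, \<phi>\<rangle>"
  by transfer (simp add: functional_iff)

lemma tensor_swap_tensor: "tensor_swap (x \<otimes>\<^sub>t y) = y \<otimes>\<^sub>t x"
  by (simp add: tensor_swap_def tensor_def vec_eq_iff mult.commute)

lemma tensor_map_left_tensor:
  assumes "vec_linear a"
  shows "tensor_map_left a (x \<otimes>\<^sub>t y) = a x \<otimes>\<^sub>t y"
proof -
  have "a (\<chi> u. x $ u * y $ h) = y $ h *s a x" for h
  proof -
    have "(\<chi> u. x $ u * y $ h) = y $ h *s x"
      by (simp add: vec_eq_iff mult.commute)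
    then show ?thesis
      using assms by (simp only: vec_linear_iff)
  qed
  then show ?thesis
    unfolding tensor_map_left_def tensor_def by (simp add: mult.commute)
qed

lemma tensor_eval_tensor: "tensor_eval (x \<otimes>\<^sub>t y) \<gamma> \<phi> = \<langle>x, \<gamma>\<rangle> * \<langle>y, \<phi>\<rangle>"
proof -
  have "(\<chi> h. x $ u * y $ h) = x $ u *s y" for u
    by (simp add: vec_eq_iff)
  moreover have "(\<chi> u. x $ u * \<langle>y, \<phi>\<rangle>) = \<langle>y, \<phi>\<rangle> *s x"
    by (simp add: vec_eq_iff mult.commute)
  ultimately show ?thesis
    by (simp add: tensor_eval_def tensor_def eval_scale mult.commute)
qed


subsection \<open>Symmetric and exterior squares\<close>

definition sym_relations :: "('a::comm_ring_1 ^ ('n::finite \<times> 'n)) set" where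
  "sym_relations = Modules.module.span (*s) {x \<otimes>\<^sub>t y - y \<otimes>\<^sub>t x |x y. True}"

definition ext_relations :: "('a::comm_ring_1 ^ ('n::finite \<times> 'n)) set" where
  "ext_relations = Modules.module.span (*s) {x \<otimes>\<^sub>t x |x. True}"

lemma equivp_mod_span:
  "equivp (\<lambda>T U :: 'a::comm_ring_1 ^ 'k. T - U \<in> Modules.module.span (*s) S)"
proof (rule equivpI)
  interpret V: Modules.module "(*s) :: 'a \<Rightarrow> 'a ^ 'k \<Rightarrow> 'a ^ 'k" by (rule module_vec)
  show "reflp (\<lambda>T U. T - U \<in> V.span S)"
    by (simp add: reflp_def V.span_zero)
  show "symp (\<lambda>T U. T - U \<in> V.span S)"
    by (metis (no_types, lifting) V.span_neg minus_diff_eq sympI)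
  show "transp (\<lambda>T U. T - U \<in> V.span S)"
    by (rule transpI) (metis (no_types, lifting) V.span_add diff_add_cancel add_diff_eq)
qed

lemma mod_span_add:
  assumes "T - U \<in> Modules.module.span (*s) S" "T' - U' \<in> Modules.module.span (*s) S"
  shows "(T + T') - (U + U' :: 'a::comm_ring_1 ^ 'k) \<in> Modules.module.span (*s) S"
  using Modules.module.span_add[OF module_vec assms] by (simp add: algebra_simps)

lemma mod_span_diff:
  assumes "T - U \<in> Modules.module.span (*s) S" "T' - U' \<in> Modules.module.span (*s) S"
  shows "(T - T') - (U - U' :: 'a::comm_ring_1 ^ 'k) \<in> Modules.module.span (*s) S"
  using Modules.module.span_diff[OF module_vec assms] by (simp add: algebra_simps)

lemma mod_span_uminus:
  assumes "T - U \<in> Modules.module.span (*s) S"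
  shows "- T - (- U :: 'a::comm_ring_1 ^ 'k) \<in> Modules.module.span (*s) S"
  using Modules.module.span_neg[OF module_vec assms] by (simp add: algebra_simps)

lemma mod_span_scale:
  assumes "T - U \<in> Modules.module.span (*s) S"
  shows "c *s T - c *s (U :: 'a::comm_ring_1 ^ 'k) \<in> Modules.module.span (*s) S"
  using Modules.module.span_scale[OF module_vec assms, of c] by (simp add: vector_ssub_ldistrib)

quotient_type (overloaded) ('a, 'n) sym2 =
    "'a::comm_ring_1 ^ ('n::finite \<times> 'n)" / "\<lambda>T U. T - U \<in> sym_relations"
  unfolding sym_relations_def by (rule equivp_mod_span)

quotient_type (overloaded) ('a, 'n) ext2 =
    "'a::comm_ring_1 ^ ('n::finite \<times> 'n)" / "\<lambda>T U. T - U \<in> ext_relations"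
  unfolding ext_relations_def by (rule equivp_mod_span)

lift_definition sym2_of :: "'a::comm_ring_1 ^ ('n::finite \<times> 'n) \<Rightarrow> ('a, 'n) sym2" is "\<lambda>T. T" .

lift_definition ext2_of :: "'a::comm_ring_1 ^ ('n::finite \<times> 'n) \<Rightarrow> ('a, 'n) ext2" is "\<lambda>T. T" .

instantiation sym2 :: (comm_ring_1, finite) ab_group_add
begin

lift_definition zero_sym2 :: "('a, 'b) sym2" is "0" .
lift_definition plus_sym2 :: "('a, 'b) sym2 \<Rightarrow> ('a, 'b) sym2 \<Rightarrow> ('a, 'b) sym2" is "(+)"
  unfolding sym_relations_def by (rule mod_span_add)
lift_definition minus_sym2 :: "('a, 'b) sym2 \<Rightarrow> ('a, 'b) sym2 \<Rightarrow> ('a, 'b) sym2" is "(-)"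
  unfolding sym_relations_def by (rule mod_span_diff)
lift_definition uminus_sym2 :: "('a, 'b) sym2 \<Rightarrow> ('a, 'b) sym2" is "uminus"
  unfolding sym_relations_def by (rule mod_span_uminus)

instance
  by standard
    (transfer; simp add: algebra_simps sym_relations_def Modules.module.span_zero[OF module_vec])+

end

instantiation ext2 :: (comm_ring_1, finite) ab_group_add
begin

lift_definition zero_ext2 :: "('a, 'b) ext2" is "0" .
lift_definition plus_ext2 :: "('a, 'b) ext2 \<Rightarrow> ('a, 'b) ext2 \<Rightarrow> ('a, 'b) ext2" is "(+)"
  unfolding ext_relations_def by (rule mod_span_add)
lift_definition minus_ext2 :: "('a, 'b) ext2 \<Rightarrow> ('a, 'b) ext2 \<Rightarrow> ('a, 'b) ext2" is "(-)"
  unfolding ext_relations_def by (rule mod_span_diff)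
lift_definition uminus_ext2 :: "('a, 'b) ext2 \<Rightarrow> ('a, 'b) ext2" is "uminus"
  unfolding ext_relations_def by (rule mod_span_uminus)

instance
  by standard
    (transfer; simp add: algebra_simps ext_relations_def Modules.module.span_zero[OF module_vec])+

end

lift_definition ext2_scale :: "'a::comm_ring_1 \<Rightarrow> ('a, 'n::finite) ext2 \<Rightarrow> ('a, 'n) ext2" is "(*s)"
  unfolding ext_relations_def by (rule mod_span_scale)

lemma module_ext2: "Modules.module (ext2_scale :: 'a::comm_ring_1 \<Rightarrow> ('a, 'n::finite) ext2 \<Rightarrow> ('a, 'n) ext2)"
  by standard
    (transfer; simp add: ext_relations_def vec_eq_iff Modules.module.span_zero[OF module_vec]
      Modules.module.scale_right_distrib[OF module_vec] Modules.module.scale_left_distrib[OF module_vec]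
      Modules.module.scale_scale[OF module_vec] Modules.module.scale_one[OF module_vec])+

definition sym_mult :: "'a::comm_ring_1 ^ 'n::finite \<Rightarrow> 'a ^ 'n \<Rightarrow> ('a, 'n) sym2" (infixl \<open>\<bullet>\<^sub>s\<close> 75) where
  "x \<bullet>\<^sub>s y = sym2_of (x \<otimes>\<^sub>t y)"

definition wedge :: "'a::comm_ring_1 ^ 'n::finite \<Rightarrow> 'a ^ 'n \<Rightarrow> ('a, 'n) ext2" (infixl \<open>\<and>\<^sub>e\<close> 75) where
  "x \<and>\<^sub>e y = ext2_of (x \<otimes>\<^sub>t y)"

text \<open>The map \<open>g \<otimes> f \<mapsto> a(g) f\<close> into the symmetric square.\<close>

definition tensor_to_sym2 ::
    "('a::comm_ring_1 ^ 'm::finite \<Rightarrow> 'a ^ 'n::finite) \<Rightarrow> 'a ^ ('m \<times> 'n) \<Rightarrow> ('a, 'n) sym2" where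
  "tensor_to_sym2 a T = sym2_of (tensor_map_left a T)"

lemma tensor_to_sym2_tensor: "vec_linear a \<Longrightarrow> tensor_to_sym2 a (g \<otimes>\<^sub>t f) = a g \<bullet>\<^sub>s f"
  by (simp add: tensor_to_sym2_def tensor_map_left_tensor sym_mult_def)

text \<open>
  Comultiplication \<open>g \<and> g' \<mapsto> g \<otimes> g' - g' \<otimes> g\<close>; the map \<open>g \<and> g' \<mapsto> a(g) \<otimes> g' - a(g') \<otimes> g\<close> and the
  pairing with \<open>\<gamma> \<and> \<gamma>'\<close> factor through it.
\<close>

lift_definition ext2_comult :: "('a::comm_ring_1, 'n::finite) ext2 \<Rightarrow> 'a ^ ('n \<times> 'n)"
  is "\<lambda>T. T - tensor_swap T"
proof -
  fix T U :: "'a ^ ('n \<times> 'n)"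
  interpret V: Modules.module "(*s) :: 'a \<Rightarrow> 'a ^ ('n \<times> 'n) \<Rightarrow> 'a ^ ('n \<times> 'n)" by (rule module_vec)
  let ?K = "{W :: 'a ^ ('n \<times> 'n). W - tensor_swap W = 0}"
  have "V.subspace ?K"
    unfolding V.subspace_def by (simp add: tensor_swap_def vec_eq_iff)
  moreover have "{x \<otimes>\<^sub>t x |x :: 'a ^ 'n. True} \<subseteq> ?K"
    by (auto simp: tensor_swap_tensor)
  ultimately have "ext_relations \<subseteq> ?K"
    unfolding ext_relations_def by (rule V.span_minimal[rotated])
  moreover assume "T - U \<in> ext_relations"
  ultimately have "T - U - tensor_swap (T - U) = 0"
    by blast
  then show "T - tensor_swap T = U - tensor_swap U"
    by (simp add: tensor_swap_def vec_eq_iff algebra_simps)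
qed

lemma ext2_comult_wedge: "ext2_comult (g \<and>\<^sub>e g') = g \<otimes>\<^sub>t g' - g' \<otimes>\<^sub>t g"
  unfolding wedge_def by transfer (simp add: tensor_swap_tensor)

definition ext2_to_tensor ::
    "('a::comm_ring_1 ^ 'm::finite \<Rightarrow> 'a ^ 'n::finite) \<Rightarrow> ('a, 'm) ext2 \<Rightarrow> 'a ^ ('n \<times> 'm)" where
  "ext2_to_tensor a z = tensor_map_left a (ext2_comult z)"

definition ext2_eval ::
    "('a::comm_ring_1, 'm::finite) ext2 \<Rightarrow> ('a, 'm) dual \<Rightarrow> ('a, 'm) dual \<Rightarrow> 'a" where
  "ext2_eval z \<gamma> \<gamma>' = tensor_eval (ext2_comult z) \<gamma> \<gamma>'"

lemma ext2_to_tensor_wedge: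
  assumes "vec_linear a"
  shows "ext2_to_tensor a (g \<and>\<^sub>e g') = a g \<otimes>\<^sub>t g' - a g' \<otimes>\<^sub>t g"
proof -
  interpret a: module_hom "(*s)" "(*s)" a by (rule assms)
  have "tensor_map_left a (T - U) = tensor_map_left a T - tensor_map_left a U" for T U :: "'a ^ ('b \<times> 'b)"
  proof -
    have "(\<chi> u. T $ (u, h) - U $ (u, h)) = (\<chi> u. T $ (u, h)) - (\<chi> u. U $ (u, h))" for h
      by (simp add: vec_eq_iff)
    then have "a (\<chi> u. T $ (u, h) - U $ (u, h)) = a (\<chi> u. T $ (u, h)) - a (\<chi> u. U $ (u, h))" for h
      by (simp only: a.diff)
    then show ?thesis
      unfolding tensor_map_left_def by (subst vec_eq_iff) simp
  qed
  then show ?thesis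
    by (simp add: ext2_to_tensor_def ext2_comult_wedge tensor_map_left_tensor[OF assms])
qed

lemma eval_diff: "\<langle>x - y, \<phi>\<rangle> = \<langle>x, \<phi>\<rangle> - \<langle>y, \<phi>\<rangle>"
  by transfer (rule module_hom.diff)

lemma ext2_eval_wedge:
  "ext2_eval (g \<and>\<^sub>e g') \<gamma> \<gamma>' = \<langle>g, \<gamma>\<rangle> * \<langle>g', \<gamma>'\<rangle> - \<langle>g, \<gamma>'\<rangle> * \<langle>g', \<gamma>\<rangle>"
proof -
  have "tensor_eval (T - U) \<gamma> \<gamma>' = tensor_eval T \<gamma> \<gamma>' - tensor_eval U \<gamma> \<gamma>'" for T U :: "'a ^ ('b \<times> 'b)"
  proof -
    have "(\<chi> h. T $ (u, h) - U $ (u, h)) = (\<chi> h. T $ (u, h)) - (\<chi> h. U $ (u, h))" for u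
      by (simp add: vec_eq_iff)
    moreover have "(\<chi> u. p u - q u) = (\<chi> u. p u) - (\<chi> u. q u)" for p q :: "'b \<Rightarrow> 'a"
      by (simp add: vec_eq_iff)
    ultimately show ?thesis
      by (simp add: tensor_eval_def eval_diff)
  qed
  then show ?thesis
    by (simp add: ext2_eval_def ext2_comult_wedge tensor_eval_tensor mult.commute)
qed

end

theory Submission
  imports Defs
begin

text \<open>
  Each half compares two functionals by evaluating them; the properties of the resolution behind
  the computation are \<open>a\<^sub>2 a\<^sub>3 = 0\<close> and the injectivity of \<open>a\<^sub>3\<close>.

  In both halves the right-hand sum is the coordinate expansion of a functional:
  \<open>\<Sum>\<^sub>h F(f\<^sub>h) \<phi>\<^sub>h\<close> is \<open>F\<close> itself (\<open>eval_dual_basis_expansion\<close>).  In (1) this \<open>F\<close> is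
  \<open>u \<mapsto> \<langle>w\<^sup>(\<^sup>2\<^sup>)\<^sub>2(e\<^sub>i \<and> e\<^sub>j \<and> e\<^sub>k \<otimes> u), \<gamma>\<^sub>s \<and> \<gamma>\<^sub>t\<rangle>\<close>, and applying \<open>a\<^sub>3\<^sup>*\<close> restricts it to boundaries
  \<open>u = a\<^sub>3(v)\<close>.  There \<open>e \<cdot> a\<^sub>3(v) = a\<^sub>1(e) v\<close> because \<open>a\<^sub>3\<close> is injective, and the term
  \<open>w\<^sup>(\<^sup>3\<^sup>)\<^sub>2(\<dots> \<and> a\<^sub>2 a\<^sub>3(v))\<close> vanishes.  The element lifted by \<open>w\<^sup>(\<^sup>2\<^sup>)\<^sub>2\<close> thereby becomes
  \<open>a\<^sub>3(p) \<otimes> v - a\<^sub>3(v) \<otimes> p\<close> with \<open>p = e\<^sub>i \<cdot> e\<^sub>j \<cdot> e\<^sub>k\<close>, which is the image of \<open>p \<and> v\<close>; since lifts along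
  \<open>\<And>\<^sup>2A\<^sub>3 \<rightarrow> A\<^sub>2 \<otimes> A\<^sub>3\<close> are unique (\<open>ext2_eval_of_boundary\<close>), \<open>F(a\<^sub>3(v))\<close> is the pairing of \<open>p \<and> v\<close>
  with \<open>\<gamma>\<^sub>s \<and> \<gamma>\<^sub>t\<close>, the value prescribed for \<open>a\<^sub>3\<^sup>*(X)\<close>.

  In (2) the functional is \<open>x \<mapsto> \<langle>w\<^sup>(\<^sup>3\<^sup>)\<^sub>2(e\<^sub>i \<and> e\<^sub>j \<and> e\<^sub>k \<and> x), \<phi>\<^sub>l \<otimes> \<gamma>\<^sub>s\<rangle>\<close>, and \<open>a\<^sub>2\<^sup>*\<close> evaluates it at
  \<open>x = a\<^sub>2(f\<^sub>h)\<close>.  This is the pairing with \<open>\<phi>\<^sub>l \<otimes> \<gamma>\<^sub>s\<close> of one term of the equation that defines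
  \<open>w\<^sup>(\<^sup>2\<^sup>)\<^sub>2\<close>.  Pairing the whole equation and solving for this term gives the condition on \<open>Y\<close>; the
  pairing of \<open>w\<^sup>(\<^sup>2\<^sup>)\<^sub>2\<close> itself turns into one with \<open>\<gamma>\<^sub>s \<and> a\<^sub>3\<^sup>*(\<phi>\<^sub>l)\<close> because the image of the
  comultiplication is antisymmetric (\<open>tensor_eval_ext2_to_tensor\<close>).
\<close>

section \<open>Functionals and dual bases\<close>

lemma functional_eval: "functional (\<lambda>x. \<langle>x, \<phi>\<rangle>)"
  by transfer

lemma eval_add: "\<langle>x + y, \<phi>\<rangle> = \<langle>x, \<phi>\<rangle> + \<langle>y, \<phi>\<rangle>"
  using functional_eval by (rule module_hom.add)

lemma eval_dual_diff: "\<langle>x, \<phi> - \<psi>\<rangle> = \<langle>x, \<phi>\<rangle> - \<langle>x, \<psi>\<rangle>"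
  by transfer simp

lemma eval_dual_scale: "\<langle>x, c *d \<phi>\<rangle> = c * \<langle>x, \<phi>\<rangle>"
  by transfer simp

lemma eval_dual_zero: "\<langle>x, 0\<rangle> = 0"
  by transfer simp

lemma eval_dual_sum: "\<langle>x, \<Sum>h\<in>A. \<phi> h\<rangle> = (\<Sum>h\<in>A. \<langle>x, \<phi> h\<rangle>)"
proof -
  have "\<langle>x, \<phi> + \<psi>\<rangle> = \<langle>x, \<phi>\<rangle> + \<langle>x, \<psi>\<rangle>" for \<phi> \<psi>
    by transfer simp
  then show ?thesis
    by (induction A rule: infinite_finite_induct) (simp_all add: eval_dual_zero)
qed

lemma functional_eq_on_basis:
  assumes "functional F" "functional G" "is_basis b" "\<And>i. F (b i) = G (b i)"
  shows "F x = G x"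
proof -
  interpret V: Modules.module "(*s) :: 'a \<Rightarrow> 'a ^ 'b \<Rightarrow> 'a ^ 'b" by (rule module_vec)
  have "x \<in> V.span (range b)"
    using assms(3) by (simp add: is_basis_def)
  then show ?thesis
    by (rule V.span_induct_alt)
      (use assms(1,2,4) in \<open>auto simp: functional_iff module_hom.zero[OF assms(1)] module_hom.zero[OF assms(2)]\<close>)
qed

lemma dual_eq_on_basis:
  assumes "is_basis b" "\<And>i. \<langle>b i, \<phi>\<rangle> = \<langle>b i, \<psi>\<rangle>"
  shows "\<phi> = \<psi>"
  by (intro dual_eqI functional_eq_on_basis[OF functional_eval functional_eval assms])

lemma eval_dual_basis_expansion:
  assumes "dual_bases b \<beta>" "functional F"
  shows "\<langle>x, \<Sum>h\<in>UNIV. F (b h) *d \<beta> h\<rangle> = F x"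
proof (rule functional_eq_on_basis[OF functional_eval assms(2)])
  show "is_basis b"
    using assms(1) by (simp add: dual_bases_def)
  have "\<langle>b i, \<beta> h\<rangle> = (if i = h then 1 else 0)" for i h
    using assms(1) by (simp add: dual_bases_def)
  then show "\<langle>b i, \<Sum>h\<in>UNIV. F (b h) *d \<beta> h\<rangle> = F (b i)" for i
    by (simp add: eval_dual_sum eval_dual_scale if_distrib[of "\<lambda>c. _ * c"] cong: if_cong)
qed

section \<open>Pairing tensors with functionals\<close>

lemma functional_tensor_eval:
  "functional (\<lambda>T :: 'a::comm_ring_1 ^ ('m::finite \<times> 'n::finite). tensor_eval T \<gamma> \<phi>)"
proof -
  have "(\<chi> h. T $ (u, h) + U $ (u, h)) = (\<chi> h. T $ (u, h)) + (\<chi> h. U $ (u, h))"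
    "(\<chi> h. c * T $ (u, h)) = c *s (\<chi> h. T $ (u, h))" for T U :: "'a ^ ('m \<times> 'n)" and u c
    by (simp_all add: vec_eq_iff)
  moreover have "(\<chi> u. p u + q u) = (\<chi> u. p u) + (\<chi> u. q u)" "(\<chi> u. c * p u) = c *s (\<chi> u. p u)"
    for p q :: "'m \<Rightarrow> 'a" and c
    by (simp_all add: vec_eq_iff)
  ultimately show ?thesis
    by (simp add: functional_iff tensor_eval_def eval_add eval_scale)
qed

lemmas tensor_eval_add = module_hom.add[OF functional_tensor_eval]
lemmas tensor_eval_diff = module_hom.diff[OF functional_tensor_eval]

lemma vec_linear_tensor_swap: "vec_linear tensor_swap"
  by (simp add: vec_linear_iff tensor_swap_def vec_eq_iff)

lemma vec_linear_tensor_map_left: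
  assumes "vec_linear a"
  shows "vec_linear (tensor_map_left a :: 'a::comm_ring_1 ^ ('m::finite \<times> 'n::finite) \<Rightarrow> 'a ^ ('k::finite \<times> 'n))"
proof -
  have "(\<chi> u. T $ (u, h) + U $ (u, h)) = (\<chi> u. T $ (u, h)) + (\<chi> u. U $ (u, h))"
    "(\<chi> u. c * T $ (u, h)) = c *s (\<chi> u. T $ (u, h))" for T U :: "'a ^ ('m \<times> 'n)" and h c
    by (simp_all add: vec_eq_iff)
  then show ?thesis
    unfolding vec_linear_iff
    by (subst (1 2) vec_eq_iff) (simp add: tensor_map_left_def module_hom.add[OF assms] module_hom.scale[OF assms])
qed

lemma inj_tensor_map_left:
  assumes "inj a"
  shows "inj (tensor_map_left a)"
proof (rule injI)
  fix T U :: "'a ^ ('b \<times> 'd)"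
  assume "tensor_map_left a T = tensor_map_left a U"
  then have "a (\<chi> u. T $ (u, h)) = a (\<chi> u. U $ (u, h))" for h
    by (simp add: tensor_map_left_def vec_eq_iff)
  then have "(\<chi> u. T $ (u, h)) = (\<chi> u. U $ (u, h))" for h
    using assms by (simp add: inj_eq)
  then show "T = U"
    by (simp add: vec_eq_iff)
qed

text \<open>Pure tensors of standard basis vectors span the tensor product.\<close>

lemma functional_eq_on_tensors:
  fixes F G :: "'a::comm_ring_1 ^ ('m::finite \<times> 'n::finite) \<Rightarrow> 'a"
  assumes "functional F" "functional G" "\<And>x y. F (x \<otimes>\<^sub>t y) = G (x \<otimes>\<^sub>t y)"
  shows "F T = G T"
proof -
  let ?B = "\<lambda>p. axis (fst p) 1 \<otimes>\<^sub>t axis (snd p) 1 :: 'a ^ ('m \<times> 'n)"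
  have "?B p $ q = (if p = q then 1 else 0)" for p q
    by (cases p; cases q) (simp add: tensor_def axis_def)
  then have "(\<Sum>p\<in>UNIV. T $ p *s ?B p) $ q = T $ q" for q
    by (simp add: if_distrib[of "\<lambda>c. _ * c"] cong: if_cong)
  then have T: "(\<Sum>p\<in>UNIV. T $ p *s ?B p) = T"
    by (simp only: vec_eq_iff simp_thms)
  have expand: "H (\<Sum>p\<in>UNIV. T $ p *s ?B p) = (\<Sum>p\<in>UNIV. T $ p * H (?B p))"
    if "functional H" for H
    by (simp add: module_hom.sum[OF that] module_hom.scale[OF that])
  show ?thesis
    using expand[OF assms(1)] expand[OF assms(2)] by (simp only: T assms(3))
qed

lemma functional_compose:
  "functional F \<Longrightarrow> vec_linear a \<Longrightarrow> functional (\<lambda>x. F (a x))"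
  by (simp add: functional_iff vec_linear_iff)

lemma tensor_eval_swap: "tensor_eval (tensor_swap T) \<phi> \<gamma> = tensor_eval T \<gamma> \<phi>"
  by (rule functional_eq_on_tensors
      [OF functional_compose[OF functional_tensor_eval vec_linear_tensor_swap] functional_tensor_eval])
    (simp add: tensor_swap_tensor tensor_eval_tensor mult.commute)

lemma tensor_eval_map_left:
  assumes "vec_linear a"
  shows "tensor_eval (tensor_map_left a T) \<phi> \<gamma> = tensor_eval T (dual_map a \<phi>) \<gamma>"
  by (rule functional_eq_on_tensors
      [OF functional_compose[OF functional_tensor_eval vec_linear_tensor_map_left[OF assms]]
        functional_tensor_eval])
    (simp add: tensor_map_left_tensor[OF assms] tensor_eval_tensor eval_dual_map[OF assms])

section \<open>Pairing bivectors with functionals\<close>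

lemma ext2_comult_add: "ext2_comult (z + z') = ext2_comult z + ext2_comult z'"
  by transfer (simp add: module_hom.add[OF vec_linear_tensor_swap])

lemma ext2_comult_scale: "ext2_comult (ext2_scale c z) = c *s ext2_comult z"
  by transfer (simp add: module_hom.scale[OF vec_linear_tensor_swap] vector_ssub_ldistrib)

lemma functional_ext2_eval:
  assumes "Modules.module_hom (*s) ext2_scale w"
  shows "functional (\<lambda>u. ext2_eval (w u) \<gamma> \<gamma>')"
  by (simp add: functional_iff ext2_eval_def module_hom.add[OF assms] module_hom.scale[OF assms]
      ext2_comult_add ext2_comult_scale tensor_eval_add module_hom.scale[OF functional_tensor_eval])

lemma ext2_eval_swap: "ext2_eval z \<gamma>' \<gamma> = - ext2_eval z \<gamma> \<gamma>'"
proof -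
  have "tensor_swap (ext2_comult z) = - ext2_comult z"
    by transfer (simp add: tensor_swap_def vec_eq_iff)
  then show ?thesis
    unfolding ext2_eval_def
    by (metis tensor_eval_swap module_hom.neg[OF functional_tensor_eval])
qed

text \<open>
  Moving \<open>a\<close> to the other side of the pairing leaves \<open>a\<^sup>*(\<phi>) \<and> \<gamma>\<close>; restoring the order
  \<open>\<gamma> \<and> a\<^sup>*(\<phi>)\<close> costs the sign.
\<close>

lemma tensor_eval_ext2_to_tensor:
  assumes "vec_linear a"
  shows "tensor_eval (ext2_to_tensor a z) \<phi> \<gamma> = - ext2_eval z \<gamma> (dual_map a \<phi>)"
proof -
  have "tensor_eval (ext2_to_tensor a z) \<phi> \<gamma> = ext2_eval z (dual_map a \<phi>) \<gamma>"
    by (simp add: ext2_to_tensor_def ext2_eval_def tensor_eval_map_left[OF assms])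
  then show ?thesis
    by (simp add: ext2_eval_swap[of z "dual_map a \<phi>"])
qed

text \<open>
  Since \<open>a \<otimes> id\<close> is injective along with \<open>a\<close>, a lift \<open>z\<close> of the image of \<open>p \<and> v\<close> has the same
  comultiplication as \<open>p \<and> v\<close>, and pairings see only the comultiplication.
\<close>

lemma ext2_eval_of_boundary:
  assumes "vec_linear a" "inj a" "ext2_to_tensor a z = a p \<otimes>\<^sub>t v - a v \<otimes>\<^sub>t p"
  shows "ext2_eval z \<gamma> \<gamma>' = \<langle>p, \<gamma>\<rangle> * \<langle>v, \<gamma>'\<rangle> - \<langle>p, \<gamma>'\<rangle> * \<langle>v, \<gamma>\<rangle>"
proof -
  have "ext2_to_tensor a z = ext2_to_tensor a (p \<and>\<^sub>e v)"
    by (simp add: assms(3) ext2_to_tensor_wedge[OF assms(1)])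
  then have "ext2_comult z = ext2_comult (p \<and>\<^sub>e v)"
    unfolding ext2_to_tensor_def by (rule injD[OF inj_tensor_map_left[OF assms(2)]])
  then show ?thesis
    using ext2_eval_wedge[of p v \<gamma> \<gamma>'] by (simp add: ext2_eval_def)
qed

section \<open>The two congruences\<close>

lemma alternating_linear:
  "alternating n s t w \<Longrightarrow> length xs = n \<Longrightarrow> i < n \<Longrightarrow> Modules.module_hom s t (\<lambda>x. w (xs[i := x]))"
  by (simp add: alternating_def)


theorem lemma3p3:
  fixes \<mm> I :: "'a::comm_ring_1 set"
    and a1 :: "'a ^ 'r1::finite \<Rightarrow> 'a"
    and a2 :: "'a ^ 'r2::finite \<Rightarrow> 'a ^ 'r1"
    and a3 :: "'a ^ 'r3::finite \<Rightarrow> 'a ^ 'r2"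
    and e :: "'r1 \<Rightarrow> 'a ^ 'r1" and f :: "'r2 \<Rightarrow> 'a ^ 'r2" and g :: "'r3 \<Rightarrow> 'a ^ 'r3"
    and \<epsilon> :: "'r1 \<Rightarrow> ('a, 'r1) dual" and \<phi> :: "'r2 \<Rightarrow> ('a, 'r2) dual"
    and \<gamma> :: "'r3 \<Rightarrow> ('a, 'r3) dual"
    and w31 :: "('a ^ 'r1) list \<Rightarrow> 'a ^ 'r2"
    and w21 :: "'a ^ 'r1 \<Rightarrow> 'a ^ 'r2 \<Rightarrow> 'a ^ 'r3"
    and w11 :: "('a ^ 'r1) list \<Rightarrow> 'a ^ 'r3"
    and w32 :: "('a ^ 'r1) list \<Rightarrow> 'a ^ ('r3 \<times> 'r2)"
    and w22 :: "('a ^ 'r1) list \<Rightarrow> 'a ^ 'r2 \<Rightarrow> ('a, 'r3) ext2"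
  assumes ring_and_resolution:
      "gorenstein_local ring_of \<mm> \<and> minimal_free_resolution3 \<mm> I a1 a2 a3 \<or>
       (\<exists>G. gorenstein_graded G \<mm> \<and> homogeneous_ideal G I \<and>
            graded_minimal_free_resolution3 G \<mm> I a1 a2 a3)"
    and char: "2 \<notin> \<mm>" "3 \<notin> \<mm>"
    and perfect: "perfect_ideal ring_of I" "ideal_height ring_of I = 3"
    and bases: "dual_bases e \<epsilon>" "dual_bases f \<phi>" "dual_bases g \<gamma>"
    and w31: "alternating 2 (*s) (*s) w31"
      "\<And>x y. a2 (w31 [x, y]) = a1 x *s y - a1 y *s x"
    and w21: "bilinear_map (*s) (*s) (*s) w21"
      "\<And>x u. a3 (w21 x u) = a1 x *s u - w31 [x, a2 u]"
    and w11: "alternating 3 (*s) (*s) w11"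
      "\<And>x y z. a3 (w11 [x, y, z]) = a1 x *s w31 [y, z] - a1 y *s w31 [x, z] + a1 z *s w31 [x, y]"
    and w32: "alternating 4 (*s) (*s) w32"
      "\<And>i j k l. tensor_to_sym2 a3 (w32 [e i, e j, e k, e l]) =
         w31 [e i, e j] \<bullet>\<^sub>s w31 [e k, e l] - w31 [e i, e k] \<bullet>\<^sub>s w31 [e j, e l]
         + w31 [e i, e l] \<bullet>\<^sub>s w31 [e j, e k]"
    and w22: "\<And>u. alternating 3 (*s) ext2_scale (\<lambda>xs. w22 xs u)"
      "\<And>xs. length xs = 3 \<Longrightarrow> Modules.module_hom (*s) ext2_scale (w22 xs)"
      "\<And>i j k u. ext2_to_tensor a3 (w22 [e i, e j, e k] u) =
         w31 [e i, e j] \<otimes>\<^sub>t w21 (e k) u - w31 [e i, e k] \<otimes>\<^sub>t w21 (e j) u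
         + w31 [e j, e k] \<otimes>\<^sub>t w21 (e i) u
         + tensor_swap (w32 [e i, e j, e k, a2 u]) - u \<otimes>\<^sub>t w11 [e i, e j, e k]"
  shows "(\<forall>i j k s t.
      \<forall>X :: ('a ^ 'r1) list \<Rightarrow> ('a, 'r3) dual list \<Rightarrow> ('a, 'r2) dual.
        (\<forall>\<alpha>s. length \<alpha>s = 2 \<longrightarrow> alternating 3 (*s) (*d) (\<lambda>xs. X xs \<alpha>s)) \<and>
        (\<forall>xs. length xs = 3 \<longrightarrow> alternating 2 (*d) (*d) (X xs)) \<and>
        dual_map a3 (X [e i, e j, e k] [\<gamma> s, \<gamma> t]) =
          \<langle>w11 [e i, e j, e k], \<gamma> s\<rangle> *d \<gamma> t - \<langle>w11 [e i, e j, e k], \<gamma> t\<rangle> *d \<gamma> s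
        \<longrightarrow> X [e i, e j, e k] [\<gamma> s, \<gamma> t]
              - (\<Sum>h\<in>UNIV. ext2_eval (w22 [e i, e j, e k] (f h)) (\<gamma> s) (\<gamma> t) *d \<phi> h)
            \<in> {\<psi>. dual_map a3 \<psi> = 0}) \<and>
    (\<forall>i j k s l.
      \<forall>Y :: ('a ^ 'r1) list \<Rightarrow> ('a, 'r3) dual \<Rightarrow> ('a, 'r2) dual \<Rightarrow> ('a, 'r1) dual.
        (\<forall>\<alpha> \<beta>. alternating 3 (*s) (*d) (\<lambda>xs. Y xs \<alpha> \<beta>)) \<and>
        (\<forall>xs. length xs = 3 \<longrightarrow> bilinear_map (*d) (*d) (*d) (Y xs)) \<and>
        (\<forall>h. \<langle>f h, dual_map a2 (Y [e i, e j, e k] (\<gamma> s) (\<phi> l))\<rangle> =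
          \<langle>w11 [e i, e j, e k], \<gamma> s\<rangle> * \<langle>f h, \<phi> l\<rangle>
          - ext2_eval (w22 [e i, e j, e k] (f h)) (\<gamma> s) (dual_map a3 (\<phi> l))
          - \<langle>w31 [e i, e j], \<phi> l\<rangle> * \<langle>w21 (e k) (f h), \<gamma> s\<rangle>
          + \<langle>w31 [e i, e k], \<phi> l\<rangle> * \<langle>w21 (e j) (f h), \<gamma> s\<rangle>
          - \<langle>w31 [e j, e k], \<phi> l\<rangle> * \<langle>w21 (e i) (f h), \<gamma> s\<rangle>)
        \<longrightarrow> Y [e i, e j, e k] (\<gamma> s) (\<phi> l)
              - (\<Sum>t\<in>UNIV. tensor_eval (w32 [e i, e j, e k, e t]) (\<gamma> s) (\<phi> l) *d \<epsilon> t)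
            \<in> {\<psi>. dual_map a2 \<psi> = 0})"
proof -
  have res: "free_resolution3 I a1 a2 a3"
    using ring_and_resolution
    by (auto simp: minimal_free_resolution3_def graded_minimal_free_resolution3_def)
  then have a2: "vec_linear a2" and a3: "vec_linear a3" "inj a3" and a2_a3: "a2 (a3 v) = 0" for v
    by (auto simp: free_resolution3_def)
  have basis_f: "is_basis f"
    using bases(2) by (simp add: dual_bases_def)
  have w31_linear: "vec_linear (\<lambda>y. w31 [x, y])" for x
    using alternating_linear[OF w31(1), of "[x, 0]" 1] by simp
  have w32_linear: "vec_linear (\<lambda>y. w32 [x, x', x'', y])" for x x' x''
    using alternating_linear[OF w32(1), of "[x, x', x'', 0]" 3] by (simp add: numeral_3_eq_3)

  have w21_boundary: "w21 x (a3 v) = a1 x *s v" for x v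
  proof (rule injD[OF a3(2)])
    show "a3 (w21 x (a3 v)) = a3 (a1 x *s v)"
      by (simp add: w21(2) a2_a3 module_hom.zero[OF w31_linear] module_hom.scale[OF a3(1)])
  qed
  have w22_boundary: "ext2_eval (w22 [e i, e j, e k] (a3 v)) \<alpha> \<beta>
      = \<langle>w11 [e i, e j, e k], \<alpha>\<rangle> * \<langle>v, \<beta>\<rangle> - \<langle>w11 [e i, e j, e k], \<beta>\<rangle> * \<langle>v, \<alpha>\<rangle>" for i j k v \<alpha> \<beta>
  proof (rule ext2_eval_of_boundary[OF a3])
    have "w31 [e i, e j] \<otimes>\<^sub>t w21 (e k) (a3 v) - w31 [e i, e k] \<otimes>\<^sub>t w21 (e j) (a3 v)
        + w31 [e j, e k] \<otimes>\<^sub>t w21 (e i) (a3 v) = a3 (w11 [e i, e j, e k]) \<otimes>\<^sub>t v"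
      by (simp add: w21_boundary w11(2) tensor_def vec_eq_iff algebra_simps)
    moreover have "tensor_swap (w32 [e i, e j, e k, a2 (a3 v)]) = 0"
      by (simp add: a2_a3 module_hom.zero[OF w32_linear] module_hom.zero[OF vec_linear_tensor_swap])
    ultimately show "ext2_to_tensor a3 (w22 [e i, e j, e k] (a3 v))
        = a3 (w11 [e i, e j, e k]) \<otimes>\<^sub>t v - a3 v \<otimes>\<^sub>t w11 [e i, e j, e k]"
      by (simp add: w22(3))
  qed
  have w32_boundary: "tensor_eval (w32 [e i, e j, e k, a2 u]) \<alpha> \<beta> =
      \<langle>w11 [e i, e j, e k], \<alpha>\<rangle> * \<langle>u, \<beta>\<rangle>
      - ext2_eval (w22 [e i, e j, e k] u) \<alpha> (dual_map a3 \<beta>)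
      - \<langle>w31 [e i, e j], \<beta>\<rangle> * \<langle>w21 (e k) u, \<alpha>\<rangle>
      + \<langle>w31 [e i, e k], \<beta>\<rangle> * \<langle>w21 (e j) u, \<alpha>\<rangle>
      - \<langle>w31 [e j, e k], \<beta>\<rangle> * \<langle>w21 (e i) u, \<alpha>\<rangle>" for i j k u \<alpha> \<beta>
    using arg_cong[OF w22(3)[of i j k u], of "\<lambda>T. tensor_eval T \<beta> \<alpha>"]
    by (simp add: tensor_eval_ext2_to_tensor[OF a3(1)] tensor_eval_add tensor_eval_diff
        tensor_eval_tensor tensor_eval_swap algebra_simps)

  have X: "\<xi> - (\<Sum>h\<in>UNIV. ext2_eval (w22 [e i, e j, e k] (f h)) \<alpha> \<beta> *d \<phi> h) \<in> {\<psi>. dual_map a3 \<psi> = 0}"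
    if "dual_map a3 \<xi> = \<langle>w11 [e i, e j, e k], \<alpha>\<rangle> *d \<beta> - \<langle>w11 [e i, e j, e k], \<beta>\<rangle> *d \<alpha>" for i j k \<alpha> \<beta> \<xi>
  proof -
    have "\<langle>a3 v, \<xi>\<rangle> = ext2_eval (w22 [e i, e j, e k] (a3 v)) \<alpha> \<beta>" for v
      using arg_cong[OF that, of "\<lambda>\<psi>. \<langle>v, \<psi>\<rangle>"]
      by (simp add: w22_boundary eval_dual_map[OF a3(1)] eval_dual_diff eval_dual_scale)
    then show ?thesis
      by (auto intro!: dual_eqI simp: eval_dual_map[OF a3(1)] eval_dual_diff eval_dual_zero
          eval_dual_basis_expansion[OF bases(2) functional_ext2_eval[OF w22(2)]])
  qed
  have Y: "\<eta> - (\<Sum>t\<in>UNIV. tensor_eval (w32 [e i, e j, e k, e t]) \<alpha> \<beta> *d \<epsilon> t) \<in> {\<psi>. dual_map a2 \<psi> = 0}"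
    if "\<And>h. \<langle>f h, dual_map a2 \<eta>\<rangle> = tensor_eval (w32 [e i, e j, e k, a2 (f h)]) \<alpha> \<beta>" for i j k \<alpha> \<beta> \<eta>
    using that
    by (auto intro!: dual_eq_on_basis[OF basis_f]
        simp: eval_dual_map[OF a2] eval_dual_diff eval_dual_zero
          eval_dual_basis_expansion[OF bases(1) functional_compose[OF functional_tensor_eval w32_linear]])
  show ?thesis
    by (intro conjI allI impI; elim conjE) (rule X, assumption, rule Y, simp add: w32_boundary)
qed

end
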